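(* Let $\mathbf A\in L(\mathbb R^n)$ be an orthogonal operator and let $X^*(t)$, $t\ge 0$, be the solution of the set differential equation $D_HX(t)=\mathbf AX(t)$ with initial value $X^*(0)=X_0^*\in\operatorname{conv}\mathbb R^n$, where $\operatorname{int}X_0^*\neq\emptyset$. Then $X^*(t)$ is Lyapunov stable: for every $\varepsilon>0$ there exists $\delta=\delta(\varepsilon,X_0^* )>0$ such that for every $X_0\in\mathfrak C$ with $\rho[\operatorname{Or}_{\mathfrak G}(X_0),\operatorname{Or}_{\mathfrak G}(X_0^* )]<\delta$, the solution $X(t)$ of $D_HX(t)=\mathbf AX(t)$, $X(0)=X_0$, satisfies $\rho[\operatorname{Or}_{\mathfrak G}(X(t)),\operatorname{Or}_{\mathfrak G}(X^*(t))]<\varepsilon$ for all $t\ge 0$.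
   Context: $\operatorname{conv}\mathbb R^n$ is the space of nonempty convex compact subsets of $\mathbb R^n$ with the Hausdorff metric $d_H$. $\mathfrak C=\{X\in\operatorname{conv}\mathbb R^n : \operatorname{int}X\neq\emptyset\}$. $\mathbf AX=\{\mathbf Ax: x\in X\}$; sums of sets are Minkowski sums. $V[X]$ is the volume. Hukuhara derivative: for $X,Y\in\operatorname{conv}\mathbb R^n$, the Hukuhara difference $X\ominus Y$ is the set $Z\in\operatorname{conv}\mathbb R^n$ with $X=Y+Z$, if it exists. $D_HX(t)$ is the element of $\operatorname{conv}\mathbb R^n$ that is the common $d_H$-limit, as $h\to0^+$, of $h^{-1}(X(t+h)\ominus X(t))$ and $h^{-1}(X(t)\ominus X(t-h))$ (only the first at $t=0$). The Cauchy problem $D_HX=\mathbf AX$, $X(0)=X_0$, has a unique solution on $[0,\infty)$, equivalently $X(t)=X_0+\int_0^t\mathbf AX(s)\,ds$ (set-valued integral); if $X_0\in\mathfrak C$ then $X(t)\in\mathfrak C$ for all $t\ge0$. $\mathfrak G$ is the group of homotheties $x\mapsto\lambda x+b$, $\lambda>0$, $b\in\mathbb R^n$, of $\mathbb R^n$, and $\operatorname{Or}_{\mathfrak G}(X)=\{\mathfrak gX:\mathfrak g\in\mathfrak G\}$ is the orbit (shape) of $X$. For $X\in\mathfrak C$ put $\widetilde X=X/\sqrt[n]{V[X]}$. For $X,Y\in\mathfrak C$, $$\rho[\operatorname{Or}_{\mathfrak G}(X),\operatorname{Or}_{\mathfrak G}(Y)]=\inf\{d_H(\widetilde X,\widetilde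 Y+x): x\in\mathbb R^n\}.$$ *)

theory Defs
  imports "HOL-Analysis.Analysis"
begin

definition conv_sets :: "(real ^ 'n) set set" where
  "conv_sets = {X. X \<noteq> {} \<and> convex X \<and> compact X}"

definition conv_bodies :: "(real ^ 'n) set set" where
  "conv_bodies = {X \<in> conv_sets. interior X \<noteq> {}}"

definition hausdorff_dist :: "(real ^ 'n) set \<Rightarrow> (real ^ 'n) set \<Rightarrow> real" where
  "hausdorff_dist X Y = max (SUP x\<in>X. infdist x Y) (SUP y\<in>Y. infdist y X)"

definition hukuhara_diff_exists :: "(real ^ 'n) set \<Rightarrow> (real ^ 'n) set \<Rightarrow> bool" where
  "hukuhara_diff_exists X Y \<longleftrightarrow> (\<exists>Z\<in>conv_sets. X = Y + Z)"

definition hukuhara_diff :: "(real ^ 'n) set \<Rightarrow> (real ^ 'n) set \<Rightarrow> (real ^ 'n) set" where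
  "hukuhara_diff X Y = (THE Z. Z \<in> conv_sets \<and> X = Y + Z)"

lemma minkowski_cancel_subset:
  fixes X Z Z' :: "(real ^ 'n) set"
  assumes X: "X \<in> conv_sets" and Z': "Z' \<in> conv_sets" and eq: "X + Z = X + Z'"
  shows "Z \<subseteq> Z'"
proof
  fix z assume z: "z \<in> Z"
  show "z \<in> Z'"
  proof (rule ccontr)
    assume "z \<notin> Z'"
    moreover have "convex Z'" "closed Z'"
      using Z' by (auto simp: conv_sets_def compact_imp_closed)
    ultimately obtain a b where ab: "a \<bullet> z < b" "\<forall>x\<in>Z'. b < a \<bullet> x"
      using separating_hyperplane_closed_point by blast
    have "continuous_on X (\<lambda>x. a \<bullet> x)" by (intro continuous_intros)
    then obtain x where x: "x \<in> X" "\<forall>y\<in>X. a \<bullet> x \<le> a \<bullet> y"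
      using continuous_attains_inf[of X "\<lambda>x. a \<bullet> x"] X by (auto simp: conv_sets_def)
    have "x + z \<in> X + Z'" using x(1) z eq by (metis set_plus_intro)
    then obtain x' z' where "x' \<in> X" "z' \<in> Z'" "x + z = x' + z'"
      by (auto simp: set_plus_def)
    moreover from this have "a \<bullet> x + a \<bullet> z = a \<bullet> x' + a \<bullet> z'"
      by (simp flip: inner_add_right)
    moreover have "a \<bullet> x \<le> a \<bullet> x'" "b < a \<bullet> z'"
      using ab(2) x(2) calculation(1,2) by auto
    ultimately show False using ab(1) by linarith
  qed
qed

lemma hukuhara_diff_eqI:
  fixes X Y Z :: "(real ^ 'n) set"
  assumes "Y \<in> conv_sets" "Z \<in> conv_sets" "X = Y + Z"
  shows "hukuhara_diff X Y = Z"
  unfolding hukuhara_diff_def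
proof (rule the_equality)
  fix W assume "W \<in> conv_sets \<and> X = Y + W"
  then show "W = Z"
    using assms minkowski_cancel_subset[of Y Z W] minkowski_cancel_subset[of Y W Z] by blast
qed (use assms in auto)

text \<open>Functions are considered on \<open>[0, \<infinity>)\<close>: at \<open>t = 0\<close> only the right-hand limit is required.\<close>

definition has_hukuhara_derivative ::
    "(real \<Rightarrow> (real ^ 'n) set) \<Rightarrow> (real ^ 'n) set \<Rightarrow> real \<Rightarrow> bool" where
  "has_hukuhara_derivative X D t \<longleftrightarrow>
     D \<in> conv_sets \<and>
     (\<forall>\<^sub>F h in at_right 0. hukuhara_diff_exists (X (t + h)) (X t)) \<and>
     ((\<lambda>h. hausdorff_dist ((*\<^sub>R) (inverse h) ` hukuhara_diff (X (t + h)) (X t)) D)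
        \<longlongrightarrow> 0) (at_right 0) \<and>
     (0 < t \<longrightarrow>
       (\<forall>\<^sub>F h in at_right 0. hukuhara_diff_exists (X t) (X (t - h))) \<and>
       ((\<lambda>h. hausdorff_dist ((*\<^sub>R) (inverse h) ` hukuhara_diff (X t) (X (t - h))) D)
          \<longlongrightarrow> 0) (at_right 0))"

definition sde_solution ::
    "(real ^ 'n \<Rightarrow> real ^ 'n) \<Rightarrow> (real ^ 'n) set \<Rightarrow> (real \<Rightarrow> (real ^ 'n) set) \<Rightarrow> bool" where
  "sde_solution A X0 X \<longleftrightarrow>
     X 0 = X0 \<and> (\<forall>t\<ge>0. X t \<in> conv_sets \<and> has_hukuhara_derivative X (A ` X t) t)"

definition homotheties :: "(real ^ 'n \<Rightarrow> real ^ 'n) set" where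
  "homotheties = {(\<lambda>x. c *\<^sub>R x + b) | c b. c > 0}"

definition homothety_orbit :: "(real ^ 'n) set \<Rightarrow> (real ^ 'n) set set" where
  "homothety_orbit X = {g ` X | g. g \<in> homotheties}"

definition vol_normalize :: "(real ^ 'n) set \<Rightarrow> (real ^ 'n) set" where
  "vol_normalize X = (*\<^sub>R) (inverse (root CARD('n) (measure lebesgue X))) ` X"

definition shape_dist_rep :: "(real ^ 'n) set \<Rightarrow> (real ^ 'n) set \<Rightarrow> real" where
  "shape_dist_rep X Y =
     Inf {hausdorff_dist (vol_normalize X) ((+) x ` vol_normalize Y) | x. True}"

text \<open>The distance is a function of the orbits; independence of the representatives
  is lemma \<open>shape_dist_orbit\<close>.\<close>

definition shape_dist :: "(real ^ 'n) set set \<Rightarrow> (real ^ 'n) set set \<Rightarrow> real" where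
  "shape_dist P Q = (THE r. \<exists>X\<in>conv_bodies. \<exists>Y\<in>conv_bodies.
     P = homothety_orbit X \<and> Q = homothety_orbit Y \<and> r = shape_dist_rep X Y)"

lemma infdist_translate: "infdist (a + x) ((+) a ` Y) = infdist x (Y :: (real ^ 'n) set)"
  by (simp add: infdist_def image_image)

lemma hausdorff_dist_translate:
  "hausdorff_dist ((+) a ` X) ((+) a ` Y) = hausdorff_dist X Y"
  by (simp add: hausdorff_dist_def image_image infdist_translate)

lemma vol_normalize_homothety:
  fixes X :: "(real ^ 'n) set"
  assumes "g \<in> homotheties"
  obtains v where "vol_normalize (g ` X) = (+) v ` vol_normalize X"
proof -
  obtain c b where g: "g = (\<lambda>x. c *\<^sub>R x + b)" and c: "c > 0"
    using assms by (auto simp: homotheties_def)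
  let ?r = "root CARD('n) (measure lebesgue X)"
  have "measure lebesgue (g ` X) = c ^ CARD('n) * measure lebesgue X"
    using measure_lebesgue_affine[of c b X] c by (simp add: g)
  then have r: "root CARD('n) (measure lebesgue (g ` X)) = c * ?r"
    using c by (simp only: real_root_mult real_root_power_cancel zero_less_card_finite order_less_imp_le)
  have "vol_normalize (g ` X) = (+) (inverse (c * ?r) *\<^sub>R b) ` vol_normalize X"
    unfolding vol_normalize_def r unfolding image_image g
  proof (rule image_cong)
    fix x assume "x \<in> X"
    show "inverse (c * ?r) *\<^sub>R (c *\<^sub>R x + b) = inverse (c * ?r) *\<^sub>R b + inverse ?r *\<^sub>R x"
      using c by (simp add: scaleR_add_right)
  qed simp
  then show ?thesis by (rule that)
qed

lemma shape_dist_rep_homothety: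
  assumes "g \<in> homotheties" "h \<in> homotheties"
  shows "shape_dist_rep (g ` X) (h ` Y) = shape_dist_rep X Y"
proof -
  obtain v where v: "vol_normalize (g ` X) = (+) v ` vol_normalize X"
    using assms(1) by (rule vol_normalize_homothety)
  obtain w where w: "vol_normalize (h ` Y) = (+) w ` vol_normalize Y"
    using assms(2) by (rule vol_normalize_homothety)
  have *: "hausdorff_dist ((+) v ` vol_normalize X) ((+) x ` (+) w ` vol_normalize Y) =
        hausdorff_dist (vol_normalize X) ((+) (x + w - v) ` vol_normalize Y)" for x
    using hausdorff_dist_translate[of v "vol_normalize X" "(+) (x + w - v) ` vol_normalize Y"]
    by (simp add: image_image algebra_simps)
  have "{hausdorff_dist (vol_normalize X) ((+) (x + w - v) ` vol_normalize Y) | x. True} =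
        (\<lambda>x. hausdorff_dist (vol_normalize X) ((+) x ` vol_normalize Y)) ` range (\<lambda>x. x + (w - v))"
    unfolding image_image by (auto simp only: image_def add_diff_eq)
  also have "range (\<lambda>x. x + (w - v)) = UNIV" by simp
  finally show ?thesis
    unfolding shape_dist_rep_def v w * by (simp add: full_SetCompr_eq)
qed

lemma homothety_orbit_self: "X \<in> homothety_orbit X"
proof -
  have "(\<lambda>x. 1 *\<^sub>R x + 0) \<in> homotheties" unfolding homotheties_def
    by (intro CollectI exI[of _ 1] exI[of _ 0] conjI refl zero_less_one)
  then have "(\<lambda>x. 1 *\<^sub>R x + 0) ` X \<in> homothety_orbit X"
    unfolding homothety_orbit_def by blast
  then show ?thesis by simp
qed

lemma shape_dist_orbit:
  fixes X Y :: "(real ^ 'n) set"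
  assumes "X \<in> conv_bodies" "Y \<in> conv_bodies"
  shows "shape_dist (homothety_orbit X) (homothety_orbit Y) =
    Inf {hausdorff_dist (vol_normalize X) ((+) x ` vol_normalize Y) | x. True}"
  unfolding shape_dist_def shape_dist_rep_def[symmetric]
proof (rule the_equality)
  fix r assume "\<exists>X'\<in>conv_bodies. \<exists>Y'\<in>conv_bodies. homothety_orbit X = homothety_orbit X' \<and>
    homothety_orbit Y = homothety_orbit Y' \<and> r = shape_dist_rep X' Y'"
  then obtain X' Y' where "X \<in> homothety_orbit X'" "Y \<in> homothety_orbit Y'"
    and r: "r = shape_dist_rep X' Y'"
    by (metis homothety_orbit_self)
  then show "r = shape_dist_rep X Y"
    by (auto simp: homothety_orbit_def shape_dist_rep_homothety)
qed (use assms in blast)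

end

theory Submission
  imports Defs
begin

text \<open>
  The support functions of a solution satisfy \<open>\<partial>/\<partial>t h(t, p) = h(t, A\<^sup>T p)\<close>, so by Taylor's theorem
  \<open>h(t, p) = (\<Sum>k. t\<^sup>k / k! h(0, (A\<^sup>T)\<^sup>k p))\<close>. Inequalities between initial support functions therefore
  persist in time; for a ball, \<open>A\<close> being orthogonal, the flow only multiplies the radius by
  \<open>exp t\<close> and moves the centre. If \<open>X\<^sub>0\<close> is close in shape to \<open>X\<^sub>0\<^sup>*\<close>, which lies between two balls
  of radii \<open>r\<close> and \<open>R\<close>, then a homothetic copy of \<open>X\<^sub>0\<close> lies between \<open>(1 - \<eta>) X\<^sub>0\<^sup>*\<close> and
  \<open>(1 + \<eta>) X\<^sub>0\<^sup>*\<close> up to translation. These inclusions persist, and after normalising volumes they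
  bound the shape distance in terms of \<open>\<eta>\<close> and \<open>R exp t / (r exp t) = R / r\<close>, uniformly in \<open>t\<close>.
\<close>

section \<open>Support functions of convex compact sets\<close>

definition support_fun :: "(real ^ 'n) set \<Rightarrow> real ^ 'n \<Rightarrow> real" where
  "support_fun X p = (SUP x\<in>X. p \<bullet> x)"

lemma conv_setsD:
  assumes "X \<in> conv_sets"
  shows "X \<noteq> {}" "convex X" "compact X" "closed X" "bounded X"
  using assms by (auto simp: conv_sets_def compact_imp_closed compact_imp_bounded)

lemma inner_le_support_fun:
  assumes "X \<in> conv_sets" "x \<in> X"
  shows "p \<bullet> x \<le> support_fun X p"
proof -
  have "compact ((\<lambda>x. p \<bullet> x) ` X)"
    using conv_setsD(3)[OF assms(1)] by (intro compact_continuous_image continuous_intros)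
  then have "bdd_above ((\<lambda>x. p \<bullet> x) ` X)"
    by (simp add: compact_imp_bounded bounded_imp_bdd_above)
  then show ?thesis
    unfolding support_fun_def using assms(2) by (rule cSUP_upper2) simp
qed

lemma support_fun_leI:
  assumes "X \<in> conv_sets" "\<And>x. x \<in> X \<Longrightarrow> p \<bullet> x \<le> b"
  shows "support_fun X p \<le> b"
  unfolding support_fun_def using assms conv_setsD(1) by (blast intro: cSUP_least)

text \<open>The summands vary independently, so the two suprema decouple; for the lower bound they
  are taken one after the other. This additivity turns Hukuhara differences into differences of real
  functions.\<close>

lemma support_fun_plus:
  assumes X: "X \<in> conv_sets" and Y: "Y \<in> conv_sets" and XY: "X + Y \<in> conv_sets"
  shows "support_fun (X + Y) p = support_fun X p + support_fun Y p"
proof (rule antisym)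
  show "support_fun (X + Y) p \<le> support_fun X p + support_fun Y p"
    using XY by (rule support_fun_leI)
      (auto simp: set_plus_def inner_add_right intro!: add_mono inner_le_support_fun X Y)
  have "support_fun X p \<le> support_fun (X + Y) p - support_fun Y p"
  proof (rule support_fun_leI[OF X])
    fix x assume x: "x \<in> X"
    have "support_fun Y p \<le> support_fun (X + Y) p - p \<bullet> x"
    proof (rule support_fun_leI[OF Y])
      fix y assume "y \<in> Y"
      then have "p \<bullet> (x + y) \<le> support_fun (X + Y) p"
        using x by (intro inner_le_support_fun[OF XY] set_plus_intro)
      then show "p \<bullet> y \<le> support_fun (X + Y) p - p \<bullet> x"
        by (simp add: inner_add_right)
    qed
    then show "p \<bullet> x \<le> support_fun (X + Y) p - support_fun Y p" by simp
  qed
  then show "support_fun X p + support_fun Y p \<le> support_fun (X + Y) p" by simp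
qed

lemma conv_sets_linear_image:
  fixes f :: "real ^ 'n \<Rightarrow> real ^ 'n"
  assumes "linear f" "X \<in> conv_sets"
  shows "f ` X \<in> conv_sets"
  using assms by (auto simp: conv_sets_def convex_linear_image
      intro!: compact_continuous_image linear_continuous_on linear_conv_bounded_linear[THEN iffD1])

lemma conv_sets_homothety:
  fixes b :: "real ^ 'n"
  assumes "X \<in> conv_sets"
  shows "(\<lambda>x. c *\<^sub>R x + b) ` X \<in> conv_sets"
  using assms convex_affinity[of X b c] compact_affinity[of X b c]
  by (auto simp: conv_sets_def add.commute)

lemma support_fun_homothety:
  assumes X: "X \<in> conv_sets" and c: "c > 0"
  shows "support_fun ((\<lambda>x. c *\<^sub>R x + b) ` X) p = c * support_fun X p + p \<bullet> b"
proof (rule antisym)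
  show "support_fun ((\<lambda>x. c *\<^sub>R x + b) ` X) p \<le> c * support_fun X p + p \<bullet> b"
    using c by (intro support_fun_leI conv_sets_homothety X)
      (auto simp: inner_add_right intro!: mult_left_mono inner_le_support_fun[OF X])
  have "support_fun X p \<le> (support_fun ((\<lambda>x. c *\<^sub>R x + b) ` X) p - p \<bullet> b) / c"
  proof (rule support_fun_leI[OF X])
    fix x assume "x \<in> X"
    then have "p \<bullet> (c *\<^sub>R x + b) \<le> support_fun ((\<lambda>x. c *\<^sub>R x + b) ` X) p"
      by (intro inner_le_support_fun conv_sets_homothety X imageI)
    then show "p \<bullet> x \<le> (support_fun ((\<lambda>x. c *\<^sub>R x + b) ` X) p - p \<bullet> b) / c"
      using c by (simp add: field_simps inner_add_right)
  qed
  then show "c * support_fun X p + p \<bullet> b \<le> support_fun ((\<lambda>x. c *\<^sub>R x + b) ` X) p"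
    using c by (simp add: field_simps)
qed

lemma support_fun_scaleR:
  assumes "X \<in> conv_sets" "c > 0"
  shows "support_fun ((*\<^sub>R) c ` X) p = c * support_fun X p"
  using support_fun_homothety[OF assms, of 0] by simp

text \<open>Moves the operator from the set to the direction. The derivative of a support function
  along a solution is thus again a support function of the same set, and differentiation can be
  iterated.\<close>

lemma support_fun_linear_image:
  assumes "linear f"
  shows "support_fun (f ` X) p = support_fun X (adjoint f p)"
  by (simp add: support_fun_def image_image adjoint_works[OF assms, symmetric]
      inner_commute[of p] inner_commute[of "adjoint f p"])

text \<open>A point outside \<open>Y\<close> is strictly separated from it by a hyperplane. The
  separation result puts the point on the low side of \<open>a\<close>, so the violated direction is
  \<open>- a\<close>.\<close>

lemma subset_support_funI:
  assumes X: "\<And>p x. x \<in> X \<Longrightarrow> p \<bullet> x \<le> support_fun Y p" and Y: "Y \<in> conv_sets"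
  shows "X \<subseteq> Y"
proof
  fix x assume x: "x \<in> X"
  show "x \<in> Y"
  proof (rule ccontr)
    assume "x \<notin> Y"
    then obtain a b where ab: "a \<bullet> x < b" "\<forall>y\<in>Y. b < a \<bullet> y"
      using separating_hyperplane_closed_point[of Y x] conv_setsD[OF Y] by blast
    have "support_fun Y (- a) \<le> - b"
      using ab(2) by (intro support_fun_leI[OF Y]) (auto intro: less_imp_le)
    with X[OF x, of "- a"] ab(1) show False by simp
  qed
qed

lemma support_fun_cball:
  assumes "r \<ge> 0"
  shows "support_fun (cball c r) p = p \<bullet> c + r * norm p"
proof (rule antisym)
  have C: "cball c r \<in> conv_sets" using assms by (simp add: conv_sets_def)
  show "support_fun (cball c r) p \<le> p \<bullet> c + r * norm p"
  proof (rule support_fun_leI[OF C])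
    fix x assume "x \<in> cball c r"
    then have "norm p * norm (x - c) \<le> norm p * r"
      by (intro mult_left_mono) (auto simp: dist_norm norm_minus_commute)
    then have "p \<bullet> (x - c) \<le> norm p * r"
      using norm_cauchy_schwarz[of p "x - c"] by linarith
    then show "p \<bullet> x \<le> p \<bullet> c + r * norm p" by (simp add: inner_diff_right mult.commute)
  qed
  \<comment> \<open>The maximiser is the boundary point in direction \<open>p\<close>; since
    \<open>sgn 0 = 0\<close>, the case \<open>p = 0\<close> needs no other witness.\<close>
  have "p \<bullet> (c + r *\<^sub>R sgn p) \<le> support_fun (cball c r) p"
    using assms by (intro inner_le_support_fun[OF C]) (auto simp: dist_norm norm_sgn)
  moreover have "p \<bullet> sgn p = norm p"
    by (cases "p = 0") (simp_all add: sgn_div_norm dot_square_norm power2_eq_square)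
  ultimately show "p \<bullet> c + r * norm p \<le> support_fun (cball c r) p"
    by (simp add: inner_add_right)
qed

lemma support_fun_mono:
  assumes "X \<subseteq> Y" "X \<in> conv_sets" "Y \<in> conv_sets"
  shows "support_fun X p \<le> support_fun Y p"
  using assms by (auto intro!: support_fun_leI inner_le_support_fun)

lemma support_fun_bound:
  assumes X: "X \<in> conv_sets" and "\<And>x. x \<in> X \<Longrightarrow> norm x \<le> M"
  shows "\<bar>support_fun X p\<bar> \<le> M * norm p"
proof -
  have le: "\<bar>p \<bullet> x\<bar> \<le> M * norm p" if "x \<in> X" for x
    using Cauchy_Schwarz_ineq2[of p x] assms(2)[OF that]
      mult_right_mono[of "norm x" M "norm p"] by (simp add: mult.commute)
  obtain x where x: "x \<in> X" using conv_setsD(1)[OF X] by blast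
  have "support_fun X p \<le> M * norm p"
    using le by (intro support_fun_leI[OF X]) (auto simp: abs_le_iff)
  with inner_le_support_fun[OF X x, of p] le[OF x] show ?thesis by linarith
qed

section \<open>Hausdorff distance and support functions\<close>

text \<open>A supremum of reals bounds its members only if they are bounded above; compactness
  ensures this for the suprema in \<open>hausdorff_dist\<close>.\<close>

lemma bdd_above_infdist:
  assumes "X \<in> conv_sets"
  shows "bdd_above ((\<lambda>x. infdist x Y) ` X)"
proof -
  have "compact ((\<lambda>x. infdist x Y) ` X)"
    using conv_setsD(3)[OF assms] by (intro compact_continuous_image continuous_intros)
  then show ?thesis by (simp add: compact_imp_bounded bounded_imp_bdd_above)
qed

lemma hausdorff_dist_commute: "hausdorff_dist X Y = hausdorff_dist Y X"
  by (simp add: hausdorff_dist_def max.commute)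

lemma infdist_le_hausdorff_dist:
  assumes "X \<in> conv_sets" "x \<in> X"
  shows "infdist x Y \<le> hausdorff_dist X Y"
  unfolding hausdorff_dist_def
  using cSUP_upper[OF assms(2) bdd_above_infdist[OF assms(1)], of Y] by linarith

lemma hausdorff_dist_nonneg:
  assumes "X \<in> conv_sets"
  shows "0 \<le> hausdorff_dist X Y"
  using infdist_le_hausdorff_dist[OF assms, of _ Y] conv_setsD(1)[OF assms] infdist_nonneg
  by (meson ex_in_conv order_trans)

lemma hausdorff_dist_leI:
  assumes "X \<in> conv_sets" "Y \<in> conv_sets"
    and "\<And>x. x \<in> X \<Longrightarrow> \<exists>y\<in>Y. dist x y \<le> d" and "\<And>y. y \<in> Y \<Longrightarrow> \<exists>x\<in>X. dist y x \<le> d"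
  shows "hausdorff_dist X Y \<le> d"
  unfolding hausdorff_dist_def
  using assms(3,4) conv_setsD(1)[OF assms(1)] conv_setsD(1)[OF assms(2)]
  by (intro max.boundedI cSUP_least) (blast intro: infdist_le2)+

text \<open>Each point of \<open>X\<close> has a nearest point in the closed set \<open>Y\<close>,
  and by Cauchy-Schwarz the two differ in direction \<open>p\<close> by at most their distance times
  \<open>norm p\<close>.\<close>

lemma support_fun_le_hausdorff_dist:
  assumes X: "X \<in> conv_sets" and Y: "Y \<in> conv_sets"
  shows "support_fun X p \<le> support_fun Y p + hausdorff_dist X Y * norm p"
proof (rule support_fun_leI[OF X])
  fix x assume x: "x \<in> X"
  obtain y where y: "y \<in> Y" "infdist x Y = dist x y"
    using infdist_attains_inf[of Y x] conv_setsD[OF Y] by blast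
  have "p \<bullet> (x - y) \<le> norm p * norm (x - y)" by (rule norm_cauchy_schwarz)
  also have "\<dots> \<le> norm p * hausdorff_dist X Y"
    using infdist_le_hausdorff_dist[OF X x, of Y] y(2)
    by (intro mult_left_mono) (auto simp: dist_norm)
  finally show "p \<bullet> x \<le> support_fun Y p + hausdorff_dist X Y * norm p"
    using inner_le_support_fun[OF Y y(1), of p] by (simp add: inner_diff_right mult.commute)
qed

lemma abs_support_fun_diff_le:
  assumes "X \<in> conv_sets" "Y \<in> conv_sets"
  shows "\<bar>support_fun X p - support_fun Y p\<bar> \<le> hausdorff_dist X Y * norm p"
  using support_fun_le_hausdorff_dist[OF assms, of p]
    support_fun_le_hausdorff_dist[OF assms(2,1), of p] by (simp add: hausdorff_dist_commute[of Y X])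

section \<open>Derivatives and Taylor series of support functions along solutions\<close>

text \<open>By additivity the support function of the scaled Hukuhara difference is an ordinary
  difference quotient, and Hausdorff convergence forces convergence of support values. Two families
  \<open>F\<close> and \<open>G\<close> let one proof serve both the forward and the backward
  quotient.\<close>

lemma tendsto_support_fun_hukuhara_quotient:
  assumes D: "D \<in> conv_sets"
    and conv: "\<forall>\<^sub>F h in at_right 0. F h \<in> conv_sets \<and> G h \<in> conv_sets"
    and ex: "\<forall>\<^sub>F h in at_right 0. hukuhara_diff_exists (F h) (G h)"
    and lim: "((\<lambda>h. hausdorff_dist ((*\<^sub>R) (inverse h) ` hukuhara_diff (F h) (G h)) D)
               \<longlongrightarrow> 0) (at_right 0)"
  shows "((\<lambda>h. (support_fun (F h) p - support_fun (G h) p) / h) \<longlongrightarrow> support_fun D p)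
           (at_right 0)"
proof (rule LIM_zero_cancel, rule Lim_null_comparison)
  let ?d = "\<lambda>h. hausdorff_dist ((*\<^sub>R) (inverse h) ` hukuhara_diff (F h) (G h)) D"
  show "((\<lambda>h. ?d h * norm p) \<longlongrightarrow> 0) (at_right 0)"
    using tendsto_mult_left_zero[OF lim] .
  show "\<forall>\<^sub>F h in at_right 0.
      norm ((support_fun (F h) p - support_fun (G h) p) / h - support_fun D p) \<le> ?d h * norm p"
    using conv ex eventually_at_right_less[of 0]
  proof eventually_elim
    case (elim h)
    then obtain Z where Z: "Z \<in> conv_sets" "F h = G h + Z"
      by (auto simp: hukuhara_diff_exists_def)
    \<comment> \<open>Minkowski cancellation makes the description in \<open>hukuhara_diff\<close>
      unique, so it denotes the witness \<open>Z\<close>.\<close>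
    have hd: "hukuhara_diff (F h) (G h) = Z"
      using elim Z by (intro hukuhara_diff_eqI) auto
    have "support_fun (F h) p = support_fun (G h) p + support_fun Z p"
      using elim Z support_fun_plus[of "G h" Z p] by auto
    then have "(support_fun (F h) p - support_fun (G h) p) / h =
        support_fun ((*\<^sub>R) (inverse h) ` Z) p"
      using elim Z(1) by (simp add: support_fun_scaleR divide_inverse mult.commute)
    moreover have "(*\<^sub>R) (inverse h) ` Z \<in> conv_sets"
      using conv_sets_homothety[OF Z(1), of "inverse h" 0] by simp
    ultimately show ?case
      using abs_support_fun_diff_le[OF _ D] by (simp add: hd)
  qed
qed

lemma sde_solutionD:
  assumes "sde_solution A X0 X" "t \<ge> 0"
  shows "X t \<in> conv_sets" "has_hukuhara_derivative X (A ` X t) t"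
  using assms by (auto simp: sde_solution_def)

text \<open>The forward and backward Hukuhara quotients give the two one-sided limits. At
  \<open>t = 0\<close> the filter within \<open>{0..}\<close> is the right-hand one, so the forward
  quotient suffices.\<close>

lemma support_fun_solution_deriv:
  assumes A: "linear A" and sol: "sde_solution A X0 X" and t: "t \<ge> 0"
  shows "((\<lambda>s. support_fun (X s) p) has_real_derivative support_fun (X t) (adjoint A p))
           (at t within {0..})"
proof -
  let ?h = "\<lambda>s. support_fun (X s) p"
  have D: "has_hukuhara_derivative X (A ` X t) t" using sde_solutionD[OF sol t] by simp
  have AX: "A ` X t \<in> conv_sets"
    using conv_sets_linear_image[OF A] sde_solutionD[OF sol t] by blast
  have pos: "\<forall>\<^sub>F h::real in at_right 0. h > 0" by (rule eventually_at_right_less)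
  have "((\<lambda>h. (?h (t + h) - ?h t) / h) \<longlongrightarrow> support_fun (A ` X t) p) (at_right 0)"
  proof (rule tendsto_support_fun_hukuhara_quotient[OF AX])
    show "\<forall>\<^sub>F h in at_right 0. X (t + h) \<in> conv_sets \<and> X t \<in> conv_sets"
      using pos by eventually_elim (use t in \<open>auto intro!: sde_solutionD[OF sol]\<close>)
  qed (use D in \<open>auto simp: has_hukuhara_derivative_def\<close>)
  then have right: "((\<lambda>s. (?h s - ?h t) / (s - t)) \<longlongrightarrow> support_fun (A ` X t) p) (at_right t)"
    unfolding filterlim_at_right_to_0[of _ _ t] by (simp add: add.commute)
  have "((\<lambda>s. (?h s - ?h t) / (s - t)) \<longlongrightarrow> support_fun (A ` X t) p) (at t within {0..})"
  proof (cases "t = 0")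
    case True
    then show ?thesis using right by (simp add: at_within_Ici_at_right)
  next
    case False
    with t have t0: "t > 0" by simp
    \<comment> \<open>For \<open>h < t\<close> the argument \<open>t - h\<close> stays in the domain
      where \<open>X\<close> is known to be convex and compact.\<close>
    have small: "\<forall>\<^sub>F h::real in at_right 0. h < t"
      using t0 by (auto simp: eventually_at_right_field)
    have "((\<lambda>h. (?h t - ?h (t - h)) / h) \<longlongrightarrow> support_fun (A ` X t) p) (at_right 0)"
    proof (rule tendsto_support_fun_hukuhara_quotient[OF AX])
      show "\<forall>\<^sub>F h in at_right 0. X t \<in> conv_sets \<and> X (t - h) \<in> conv_sets"
        using small by eventually_elim (use t in \<open>auto intro!: sde_solutionD[OF sol]\<close>)
    qed (use D t0 in \<open>auto simp: has_hukuhara_derivative_def\<close>)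
    moreover have "(?h (t - h) - ?h t) / (t - h - t) = (?h t - ?h (t - h)) / h" for h
      using minus_divide_divide[of "?h t - ?h (t - h)" h] by simp
    ultimately have "((\<lambda>s. (?h s - ?h t) / (s - t)) \<longlongrightarrow> support_fun (A ` X t) p) (at_left t)"
      unfolding filterlim_at_left_to_right[of _ _ t] filterlim_at_right_to_0[of _ _ "- t"]
      by simp
    then have "((\<lambda>s. (?h s - ?h t) / (s - t)) \<longlongrightarrow> support_fun (A ` X t) p) (at t)"
      using right by (rule filterlim_split_at)
    then show ?thesis
      using t0 by (simp add: at_within_interior[of t "{0..}"])
  qed
  then show ?thesis
    unfolding has_field_derivative_iff support_fun_linear_image[OF A] .
qed

text \<open>Boundedness needs no continuity of \<open>X\<close> in the Hausdorff metric: \<open>X t\<close> lies in the box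
  cut out by the finitely many support values in the coordinate directions.\<close>

lemma solution_bounded:
  fixes A :: "real ^ 'n \<Rightarrow> real ^ 'n"
  assumes A: "linear A" and sol: "sde_solution A X0 X"
  obtains M where "\<And>s x. s \<in> {0..t} \<Longrightarrow> x \<in> X s \<Longrightarrow> norm x \<le> M"
proof -
  have "\<exists>B. \<forall>s\<in>{0..t}. \<bar>support_fun (X s) p\<bar> \<le> B" for p
  proof -
    have "continuous_on {0..} (\<lambda>s. support_fun (X s) p)"
      by (rule DERIV_continuous_on) (rule support_fun_solution_deriv[OF A sol], simp)
    then have "continuous_on {0..t} (\<lambda>s. support_fun (X s) p)"
      by (rule continuous_on_subset) auto
    then have "bounded ((\<lambda>s. support_fun (X s) p) ` {0..t})"
      by (intro compact_imp_bounded compact_continuous_image) auto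
    then show ?thesis by (auto simp: bounded_iff)
  qed
  then obtain B where B: "\<And>p s. s \<in> {0..t} \<Longrightarrow> \<bar>support_fun (X s) p\<bar> \<le> B p" by metis
  show ?thesis
  proof (rule that)
    fix s x assume s: "s \<in> {0..t}" and x: "x \<in> X s"
    have Xs: "X s \<in> conv_sets" using sde_solutionD[OF sol] s by auto
    have "norm x \<le> (\<Sum>b\<in>Basis. \<bar>x \<bullet> b\<bar>)" by (rule norm_le_l1)
    also have "\<dots> \<le> (\<Sum>b\<in>Basis. B b + B (- b))"
    proof (rule sum_mono)
      fix b :: "real ^ 'n"
      have "b \<bullet> x \<le> support_fun (X s) b" "- b \<bullet> x \<le> support_fun (X s) (- b)"
        using inner_le_support_fun[OF Xs x] by blast+
      then show "\<bar>x \<bullet> b\<bar> \<le> B b + B (- b)"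
        using B[OF s, of b] B[OF s, of "- b"] by (simp add: inner_commute)
    qed
    finally show "norm x \<le> (\<Sum>b\<in>Basis. B b + B (- b))" .
  qed
qed

text \<open>Every \<open>p\<close> has the form \<open>A q\<close>, and the adjoint of an orthogonal
  operator undoes it.\<close>

lemma norm_adjoint_orthogonal:
  fixes A :: "real ^ 'n \<Rightarrow> real ^ 'n"
  assumes "orthogonal_transformation A"
  shows "norm (adjoint A p) = norm p"
proof -
  have lin: "linear A" using assms by (rule orthogonal_transformation_linear)
  obtain q where q: "p = A q"
    using orthogonal_transformation_surj[OF assms] by blast
  have "adjoint A (A q) = q"
  proof (rule vector_eq_ldot[THEN iffD1], rule allI)
    show "x \<bullet> adjoint A (A q) = x \<bullet> q" for x
      using assms by (simp add: adjoint_works[OF lin] orthogonal_transformation_def)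
  qed
  then show ?thesis
    using assms by (simp add: q orthogonal_transformation_norm)
qed

lemma norm_adjoint_orthogonal_funpow:
  fixes A :: "real ^ 'n \<Rightarrow> real ^ 'n"
  assumes "orthogonal_transformation A"
  shows "norm ((adjoint A ^^ k) p) = norm p"
  by (induction k) (simp_all add: norm_adjoint_orthogonal[OF assms])

text \<open>Since \<open>adjoint A\<close> preserves norms and the sets \<open>X s\<close> are
  uniformly bounded on \<open>{0..t}\<close>, all derivatives share one bound there, so the Taylor
  remainder tends to zero.\<close>

lemma support_fun_solution_sums:
  assumes A: "orthogonal_transformation A" and sol: "sde_solution A X0 X" and t: "t \<ge> 0"
  shows "(\<lambda>k. t ^ k / fact k * support_fun X0 ((adjoint A ^^ k) p)) sums support_fun (X t) p"
proof -
  have lin: "linear A" using A by (rule orthogonal_transformation_linear)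
  \<comment> \<open>\<open>u k\<close> is the \<open>k\<close>-th derivative of the support function
    in direction \<open>p\<close>.\<close>
  define u where "u k s = support_fun (X s) ((adjoint A ^^ k) p)" for k s
  obtain M where M: "\<And>s x. s \<in> {0..t} \<Longrightarrow> x \<in> X s \<Longrightarrow> norm x \<le> M"
    using solution_bounded[OF lin sol] by blast
  have bound: "norm (u k s) \<le> M * norm p" if "s \<in> {0..t}" for k s
    using support_fun_bound[of "X s" M "(adjoint A ^^ k) p"] M[OF that] that
      sde_solutionD(1)[OF sol, of s]
    by (simp add: u_def norm_adjoint_orthogonal_funpow[OF A])
  \<comment> \<open>The remainder has \<open>fact n\<close> rather than \<open>fact (Suc n)\<close>
    in the denominator; it still vanishes, being a constant times a term of the exponential
    series.\<close>
  have Taylor: "norm (u 0 t - (\<Sum>k\<le>n. u k 0 * (t - 0) ^ k / fact k))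
      \<le> M * norm p * norm (t - 0) ^ Suc n / fact n" for n
  proof (rule field_Taylor[where S = "{0..t}" and f = u])
    fix k s assume s: "s \<in> {0..t}"
    have "(u k has_real_derivative u (Suc k) s) (at s within {0..})"
      using support_fun_solution_deriv[OF lin sol, of s "(adjoint A ^^ k) p"] s
      by (simp add: u_def[abs_def])
    then show "(u k has_real_derivative u (Suc k) s) (at s within {0..t})"
      by (rule DERIV_subset) auto
  qed (use bound t in auto)
  have lim: "(\<lambda>n. (M * norm p * t) * (t ^ n / fact n)) \<longlonglongrightarrow> (M * norm p * t) * 0"
    using summable_LIMSEQ_zero[OF summable_exp[of t]]
    by (intro tendsto_mult tendsto_const) (simp add: field_simps)
  have le: "norm (u 0 t - (\<Sum>k\<le>n. u k 0 * t ^ k / fact k))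
      \<le> (M * norm p * t) * (t ^ n / fact n)" for n
    using Taylor[of n] t by (simp add: mult.assoc)
  have "(\<lambda>n. u 0 t - (\<Sum>k\<le>n. u k 0 * t ^ k / fact k)) \<longlonglongrightarrow> 0"
    by (rule Lim_null_comparison[OF always_eventually[OF allI[OF le]]]) (use lim in simp)
  then have "(\<lambda>n. u 0 t - (u 0 t - (\<Sum>k\<le>n. u k 0 * t ^ k / fact k))) \<longlonglongrightarrow> u 0 t - 0"
    by (intro tendsto_diff tendsto_const)
  then have "(\<lambda>k. u k 0 * t ^ k / fact k) sums u 0 t"
    by (simp add: sums_def_le)
  then show ?thesis
    using sol by (simp add: u_def sde_solution_def mult_ac)
qed

section \<open>Exponential flow and propagation of inequalities\<close>

text \<open>This is the operator exponential exp(tA) applied to \<open>y\<close>; it transports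
  centres and translation vectors.\<close>

definition exp_flow :: "(real ^ 'n \<Rightarrow> real ^ 'n) \<Rightarrow> real \<Rightarrow> real ^ 'n \<Rightarrow> real ^ 'n" where
  "exp_flow A t y = (\<Sum>k. (t ^ k / fact k) *\<^sub>R (A ^^ k) y)"

text \<open>The analogue of \<open>support_fun_solution_sums\<close> for a single point, whose
  support function is linear: the powers of the adjoint pass to the other side of the inner
  product.\<close>

lemma exp_flow_sums:
  assumes A: "orthogonal_transformation A"
  shows "(\<lambda>k. t ^ k / fact k * ((adjoint A ^^ k) p \<bullet> y)) sums (p \<bullet> exp_flow A t y)"
proof -
  have lin: "linear A" using A by (rule orthogonal_transformation_linear)
  have norm_pow: "norm ((A ^^ k) y) = norm y" for k
    by (induction k) (simp_all add: orthogonal_transformation_norm[OF A])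
  have adj: "(adjoint A ^^ k) p \<bullet> z = p \<bullet> (A ^^ k) z" for k z
  proof (induction k arbitrary: z)
    case (Suc k)
    have "(adjoint A ^^ Suc k) p \<bullet> z = (adjoint A ^^ k) p \<bullet> A z"
      using adjoint_works[OF lin, of z] by (simp add: inner_commute)
    then show ?case by (simp add: Suc.IH funpow_swap1)
  qed simp
  have "summable (\<lambda>k. \<bar>t\<bar> ^ k / fact k * norm y)"
    using summable_mult2[OF summable_exp[of "\<bar>t\<bar>"], of "norm y"] by (simp add: field_simps)
  then have "summable (\<lambda>k. (t ^ k / fact k) *\<^sub>R (A ^^ k) y)"
    using summable_norm_cancel[of "\<lambda>k. (t ^ k / fact k) *\<^sub>R (A ^^ k) y"]
    by (simp add: norm_pow power_abs)
  then have "(\<lambda>k. (t ^ k / fact k) *\<^sub>R (A ^^ k) y) sums exp_flow A t y"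
    unfolding exp_flow_def by (rule summable_sums)
  then have "(\<lambda>k. p \<bullet> ((t ^ k / fact k) *\<^sub>R (A ^^ k) y)) sums (p \<bullet> exp_flow A t y)"
    by (rule bounded_linear.sums[OF bounded_linear_inner_right])
  then show ?thesis by (simp add: adj)
qed

text \<open>The norm is the support function of the unit ball. Orthogonality makes all terms
  multiples of the same \<open>norm p\<close>, so a ball only grows by the factor
  \<open>exp t\<close>.\<close>

lemma exp_norm_sums:
  fixes A :: "real ^ 'n \<Rightarrow> real ^ 'n"
  assumes A: "orthogonal_transformation A"
  shows "(\<lambda>k. t ^ k / fact k * norm ((adjoint A ^^ k) p)) sums (exp t * norm p)"
proof -
  have "t ^ k / fact k * norm ((adjoint A ^^ k) p) = t ^ k /\<^sub>R fact k * norm p" for k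
    by (simp only: norm_adjoint_orthogonal_funpow[OF A]) (simp add: field_simps)
  then show ?thesis
    using sums_mult2[OF exp_converges[of t], of "norm p"] by (simp only:)
qed

text \<open>The flow on support functions is a positive linear operator.\<close>

lemma solution_inequality_propagates:
  assumes A: "orthogonal_transformation A" and t: "t \<ge> 0"
    and K: "sde_solution A K0 K" and L: "sde_solution A L0 L"
    and init: "\<And>q. 0 \<le> a * support_fun K0 q + b * support_fun L0 q
                      + e * (q \<bullet> y) + f * (q \<bullet> z) + d * norm q"
  shows "0 \<le> a * support_fun (K t) p + b * support_fun (L t) p
               + e * (p \<bullet> exp_flow A t y) + f * (p \<bullet> exp_flow A t z) + d * (exp t * norm p)"
proof -
  let ?w = "\<lambda>k. t ^ k / fact k" and ?p = "\<lambda>k. (adjoint A ^^ k) p"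
  have sums: "(\<lambda>k. a * (?w k * support_fun K0 (?p k)) + b * (?w k * support_fun L0 (?p k))
             + e * (?w k * (?p k \<bullet> y)) + f * (?w k * (?p k \<bullet> z)) + d * (?w k * norm (?p k)))
      sums (a * support_fun (K t) p + b * support_fun (L t) p
             + e * (p \<bullet> exp_flow A t y) + f * (p \<bullet> exp_flow A t z) + d * (exp t * norm p))"
    by (intro sums_add sums_mult support_fun_solution_sums[OF A K t]
        support_fun_solution_sums[OF A L t] exp_flow_sums[OF A] exp_norm_sums[OF A])
  \<comment> \<open>The \<open>k\<close>-th term is \<open>init\<close> at the direction
    \<open>?p k\<close>, times a weight that is nonnegative because \<open>t\<close> is.\<close>
  have nonneg: "0 \<le> a * (?w k * support_fun K0 (?p k)) + b * (?w k * support_fun L0 (?p k))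
             + e * (?w k * (?p k \<bullet> y)) + f * (?w k * (?p k \<bullet> z)) + d * (?w k * norm (?p k))" for k
    using mult_nonneg_nonneg[OF _ init[of "?p k"], of "?w k"] t
    by (simp add: distrib_left mult.left_commute)
  show ?thesis
    by (rule sums_le[OF nonneg sums_zero sums])
qed

section \<open>Volume normalisation\<close>

text \<open>The root makes this scale like a length, so nested homothetic bodies give linear bounds
  on it.\<close>

definition vol_radius :: "(real ^ 'n) set \<Rightarrow> real" where
  "vol_radius X = root CARD('n) (measure lebesgue X)"

lemma vol_normalize_eq: "vol_normalize X = (*\<^sub>R) (inverse (vol_radius X)) ` X"
  by (simp add: vol_normalize_def vol_radius_def)

lemma vol_radius_mono:
  assumes "X \<in> conv_sets" "Y \<in> conv_sets" "X \<subseteq> Y"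
  shows "vol_radius X \<le> vol_radius Y"
proof -
  have "X \<in> lmeasurable" "Y \<in> lmeasurable"
    using assms by (simp_all add: lmeasurable_compact conv_setsD(3))
  then have "measure lebesgue X \<le> measure lebesgue Y"
    using assms(3) by (intro measure_mono_fmeasurable fmeasurableD)
  then show ?thesis by (simp add: vol_radius_def)
qed

lemma vol_radius_homothety:
  fixes X :: "(real ^ 'n) set"
  assumes "c > 0"
  shows "vol_radius ((\<lambda>x. c *\<^sub>R x + b) ` X) = c * vol_radius X"
proof -
  have "measure lebesgue ((\<lambda>x. c *\<^sub>R x + b) ` X) = c ^ CARD('n) * measure lebesgue X"
    using measure_lebesgue_affine[of c b X] assms by simp
  then show ?thesis
    using assms by (simp only: vol_radius_def real_root_mult real_root_power_cancel
        zero_less_card_finite order_less_imp_le)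
qed

lemma vol_radius_scaleR:
  assumes "c > 0"
  shows "vol_radius ((*\<^sub>R) c ` X) = c * vol_radius X"
  using vol_radius_homothety[OF assms, of 0 X] by simp

lemma vol_radius_cball:
  fixes c :: "real ^ 'n"
  assumes "r > 0"
  shows "vol_radius (cball c r) = r * vol_radius (cball (0 :: real ^ 'n) 1)"
proof -
  have "(\<lambda>x. r *\<^sub>R x + c) ` cball 0 1 = cball c r"
    using cball_scale[of r "0 :: real ^ 'n" 1, symmetric] cball_translation[of c 0 r] assms
    by (simp add: image_comp o_def add.commute)
  then show ?thesis
    using vol_radius_homothety[OF assms, of c "cball 0 1"] by simp
qed

lemma vol_radius_unit_ball_pos: "vol_radius (cball (0 :: real ^ 'n) 1) > 0"
  by (simp add: vol_radius_def)

lemma conv_sets_cball: "r \<ge> 0 \<Longrightarrow> cball c r \<in> conv_sets"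
  by (simp add: conv_sets_def)

lemma vol_radius_ge:
  fixes X :: "(real ^ 'n) set"
  assumes "X \<in> conv_sets" "cball c r \<subseteq> X" "r > 0"
  shows "r * vol_radius (cball (0 :: real ^ 'n) 1) \<le> vol_radius X"
  using vol_radius_mono[OF conv_sets_cball assms(1,2)] assms(3) unfolding vol_radius_cball[OF assms(3)] by simp

lemma conv_bodies_contains_cball:
  assumes "X \<in> conv_bodies"
  obtains c r where "r > 0" "cball c r \<subseteq> X"
proof -
  obtain c where "c \<in> interior X" using assms by (auto simp: conv_bodies_def)
  then show ?thesis using that by (auto simp: mem_interior_cball)
qed

lemma vol_radius_pos:
  fixes X :: "(real ^ 'n) set"
  assumes "X \<in> conv_bodies"
  shows "vol_radius X > 0"
proof -
  obtain c r where "r > 0" "cball c r \<subseteq> X"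
    using assms by (rule conv_bodies_contains_cball)
  then show ?thesis
    using less_le_trans[OF mult_pos_pos vol_radius_ge[of X c r]] assms
      vol_radius_unit_ball_pos[where 'n='n] by (simp add: conv_bodies_def)
qed

lemma conv_bodiesI:
  assumes "X \<in> conv_sets" "cball c r \<subseteq> X" "r > 0"
  shows "X \<in> conv_bodies"
  using assms mem_interior_cball[of c X] by (auto simp: conv_bodies_def)

lemma conv_sets_vol_normalize:
  assumes "X \<in> conv_sets"
  shows "vol_normalize X \<in> conv_sets"
  using conv_sets_homothety[OF assms, of "inverse (vol_radius X)" 0] by (simp add: vol_normalize_eq)

section \<open>Shape distance of bodies squeezed between homothetic copies\<close>

text \<open>Nesting confines the ratio of the two volume radii to
  \<open>[1 - \<eta>, 1 + \<eta>]\<close>. After normalisation, matching points are multiples of one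
  \<open>k\<close> in \<open>K\<close> with relative error at most
  \<open>2 * \<eta> / (1 - \<eta>)\<close>, while the normalised length of \<open>k\<close> is
  bounded through \<open>R\<close> and the inscribed ball.\<close>

lemma shape_dist_rep_le:
  fixes K L :: "(real ^ 'n) set"
  assumes K: "K \<in> conv_sets" and L: "L \<in> conv_sets"
    and r: "r > 0" "cball 0 r \<subseteq> K" and R: "K \<subseteq> cball 0 R"
    and \<eta>: "0 \<le> \<eta>" "\<eta> < 1"
    and KL: "(*\<^sub>R) (1 - \<eta>) ` K \<subseteq> L" and LK: "L \<subseteq> (*\<^sub>R) (1 + \<eta>) ` K"
  shows "shape_dist_rep L K \<le>
    2 * \<eta> / (1 - \<eta>) * (R / (r * vol_radius (cball (0 :: real ^ 'n) 1)))"
proof -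
  let ?v = "vol_radius K" and ?w = "vol_radius L"
  let ?\<kappa> = "vol_radius (cball (0 :: real ^ 'n) 1)"
  let ?d = "2 * \<eta> / (1 - \<eta>) * (R / (r * ?\<kappa>))"
  have scale: "(*\<^sub>R) c ` K \<in> conv_sets" for c
    using conv_sets_homothety[OF K, of c 0] by simp
  have \<kappa>: "r * ?\<kappa> > 0" using r(1) vol_radius_unit_ball_pos[where 'n='n] by simp
  have v: "r * ?\<kappa> \<le> ?v" using vol_radius_ge[OF K r(2,1)] .
  have v0: "?v > 0" using \<kappa> v by linarith
  have w1: "(1 - \<eta>) * ?v \<le> ?w"
    using vol_radius_mono[OF scale L KL] \<eta> by (simp add: vol_radius_scaleR)
  have w2: "?w \<le> (1 + \<eta>) * ?v"
    using vol_radius_mono[OF L scale LK] \<eta> by (simp add: vol_radius_scaleR)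
  have w0: "?w > 0" using w1 v0 \<eta> by (smt (verit) mult_pos_pos)
  \<comment> \<open>Used with \<open>s\<close> equal to \<open>(1 + \<eta>) / ?w\<close> and
    \<open>(1 - \<eta>) / ?w\<close>; \<open>s * ?v - 1\<close> is the relative error against
    \<open>inverse ?v\<close>.\<close>
  have dist_le: "dist (s *\<^sub>R k) (inverse ?v *\<^sub>R k) \<le> ?d"
    if k: "k \<in> K" and s: "\<bar>s * ?v - 1\<bar> \<le> 2 * \<eta> / (1 - \<eta>)" for s k
  proof -
    have "s *\<^sub>R k - inverse ?v *\<^sub>R k = ((s * ?v - 1) / ?v) *\<^sub>R k"
      using v0 by (simp add: field_simps flip: scaleR_left_diff_distrib)
    then have "dist (s *\<^sub>R k) (inverse ?v *\<^sub>R k) = \<bar>s * ?v - 1\<bar> * (norm k / ?v)"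
      using v0 by (simp add: dist_norm)
    also have "\<dots> \<le> 2 * \<eta> / (1 - \<eta>) * (R / (r * ?\<kappa>))"
    proof (rule mult_mono[OF s])
      have "norm k \<le> R" using k R by auto
      then show "norm k / ?v \<le> R / (r * ?\<kappa>)"
        using \<kappa> v by (intro frac_le) (auto intro: order_trans[OF norm_ge_zero])
    qed (use \<eta> v0 in auto)
    finally show ?thesis .
  qed
  have *: "\<bar>(1 + \<eta>) / ?w * ?v - 1\<bar> \<le> 2 * \<eta> / (1 - \<eta>)"
  proof -
    have "?v / ?w \<le> 1 / (1 - \<eta>)" using w1 w0 \<eta> by (simp add: field_simps)
    then have "(1 + \<eta>) / ?w * ?v \<le> (1 + \<eta>) / (1 - \<eta>)"
      using mult_left_mono[of "?v / ?w" "1 / (1 - \<eta>)" "1 + \<eta>"] \<eta> by simp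
    moreover have "(1 + \<eta>) / (1 - \<eta>) - 1 = 2 * \<eta> / (1 - \<eta>)"
      using \<eta> by (simp add: field_simps)
    moreover have "(1 + \<eta>) / ?w * ?v \<ge> 1" using w2 w0 by (simp add: field_simps)
    ultimately show ?thesis by linarith
  qed
  have **: "\<bar>(1 - \<eta>) / ?w * ?v - 1\<bar> \<le> 2 * \<eta> / (1 - \<eta>)"
  proof -
    have "1 / (1 + \<eta>) \<le> ?v / ?w" using w2 w0 \<eta> by (simp add: field_simps)
    then have "(1 - \<eta>) / (1 + \<eta>) \<le> (1 - \<eta>) / ?w * ?v"
      using mult_left_mono[of "1 / (1 + \<eta>)" "?v / ?w" "1 - \<eta>"] \<eta> by simp
    moreover have "1 - (1 - \<eta>) / (1 + \<eta>) = 2 * \<eta> / (1 + \<eta>)"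
      using \<eta> by (simp add: field_simps)
    moreover have "2 * \<eta> / (1 + \<eta>) \<le> 2 * \<eta> / (1 - \<eta>)"
      using \<eta> by (intro frac_le) auto
    moreover have "(1 - \<eta>) / ?w * ?v \<le> 1" using w1 w0 by (simp add: field_simps)
    ultimately show ?thesis by linarith
  qed
  have "hausdorff_dist (vol_normalize L) (vol_normalize K) \<le> ?d"
  proof (rule hausdorff_dist_leI[OF conv_sets_vol_normalize[OF L] conv_sets_vol_normalize[OF K]])
    fix x assume "x \<in> vol_normalize L"
    then obtain k where k: "k \<in> K" "x = inverse ?w *\<^sub>R (1 + \<eta>) *\<^sub>R k"
      using LK by (auto simp: vol_normalize_eq)
    then have "x = ((1 + \<eta>) / ?w) *\<^sub>R k" by (simp add: divide_inverse mult.commute)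
    then have "dist x (inverse ?v *\<^sub>R k) \<le> ?d" using dist_le[OF k(1) *] by simp
    moreover have "inverse ?v *\<^sub>R k \<in> vol_normalize K"
      unfolding vol_normalize_eq using k(1) by (rule imageI)
    ultimately show "\<exists>y\<in>vol_normalize K. dist x y \<le> ?d" by blast
  next
    fix y assume "y \<in> vol_normalize K"
    then obtain k where k: "k \<in> K" "y = inverse ?v *\<^sub>R k"
      by (auto simp: vol_normalize_eq)
    then have "inverse ?w *\<^sub>R (1 - \<eta>) *\<^sub>R k \<in> vol_normalize L"
      unfolding vol_normalize_eq using KL by blast
    then have "((1 - \<eta>) / ?w) *\<^sub>R k \<in> vol_normalize L"
      by (simp add: divide_inverse mult.commute)
    moreover have "dist y (((1 - \<eta>) / ?w) *\<^sub>R k) \<le> ?d"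
      using dist_le[OF k(1) **] k(2) by (simp add: dist_commute)
    ultimately show "\<exists>x\<in>vol_normalize L. dist y x \<le> ?d" by blast
  qed
  \<comment> \<open>The translation by zero is one candidate in the infimum; nonnegativity of the
    distance supplies the lower bound that the infimum needs.\<close>
  moreover have "shape_dist_rep L K \<le> hausdorff_dist (vol_normalize L) ((+) 0 ` vol_normalize K)"
    unfolding shape_dist_rep_def
    using hausdorff_dist_nonneg[OF conv_sets_vol_normalize[OF L]]
    by (intro cInf_lower CollectI exI[of _ 0] conjI refl TrueI bdd_belowI[where m = 0]) auto
  ultimately show ?thesis by (simp add: image_cong[of _ _ "(+) 0" id])
qed

text \<open>Closeness at time zero is recast as linear inequalities between support functions, which
  the flow preserves. Both radii gain the factor \<open>exp t\<close>, so it cancels and the bound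
  is uniform in \<open>t\<close>.\<close>

lemma solution_shape_dist_le:
  fixes A :: "real ^ 'n \<Rightarrow> real ^ 'n"
  assumes A: "orthogonal_transformation A" and t: "t \<ge> 0"
    and solK: "sde_solution A K0 K" and solL: "sde_solution A L0 L"
    and r: "r > 0" "cball c r \<subseteq> K0" and R: "K0 \<subseteq> cball c R"
    and a: "a > 0" and \<eta>: "0 \<le> \<eta>" "\<eta> < 1"
    and close: "\<And>q. \<bar>a * support_fun L0 q - support_fun K0 q - q \<bullet> b\<bar> \<le> \<eta> * (r * norm q)"
  shows "shape_dist (homothety_orbit (L t)) (homothety_orbit (K t)) \<le>
    2 * \<eta> / (1 - \<eta>) * (R / (r * vol_radius (cball (0 :: real ^ 'n) 1)))"
proof -
  have K0: "K0 \<in> conv_sets"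
    using sde_solutionD(1)[OF solK, of 0] solK by (simp add: sde_solution_def)
  have Kt: "K t \<in> conv_sets" and Lt: "L t \<in> conv_sets"
    using sde_solutionD(1)[OF solK t] sde_solutionD(1)[OF solL t] .
  have "R \<ge> 0" using r R by (metis cball_eq_empty conv_setsD(1)[OF K0] not_less subset_empty)
  have lower0: "q \<bullet> c + r * norm q \<le> support_fun K0 q" for q
    using support_fun_mono[OF r(2) conv_sets_cball K0, of q] r(1) by (simp add: support_fun_cball)
  have upper0: "support_fun K0 q \<le> q \<bullet> c + R * norm q" for q
    using support_fun_mono[OF R K0 conv_sets_cball, of q] \<open>R \<ge> 0\<close> by (simp add: support_fun_cball)
  \<comment> \<open>The inscribed ball bounds \<open>r * norm q\<close> by the support function of
    \<open>K0\<close> recentred at \<open>c\<close>; the error thereby becomes a multiple of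
    \<open>K0\<close> itself and evolves with it.\<close>
  have close0: "\<bar>a * support_fun L0 q - support_fun K0 q - q \<bullet> b\<bar>
      \<le> \<eta> * support_fun K0 q - \<eta> * (q \<bullet> c)" for q
    using close[of q] lower0[of q] mult_left_mono[of "r * norm q" "support_fun K0 q - q \<bullet> c" \<eta>] \<eta>(1)
    by (simp add: right_diff_distrib)
  note propagate = solution_inequality_propagates[OF A t solK solL, where y = c and z = b]
  define c' where "c' = exp_flow A t c"
  define b' where "b' = exp_flow A t b"
  define K' where "K' = (\<lambda>x. 1 *\<^sub>R x + - c') ` K t"
  \<comment> \<open>Besides the recentring by \<open>c'\<close> shared with \<open>K'\<close>, the
    flowed offset \<open>b'\<close> is removed. The factor 1 in \<open>K'\<close> gives it the form
    of a homothety as well.\<close>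
  define L' where "L' = (\<lambda>x. a *\<^sub>R x + (- b' - c')) ` L t"
  have K': "K' \<in> conv_sets" and L': "L' \<in> conv_sets"
    unfolding K'_def L'_def by (intro conv_sets_homothety Kt Lt)+
  have sK: "support_fun K' p = support_fun (K t) p - p \<bullet> c'" for p
    unfolding K'_def by (subst support_fun_homothety[OF Kt]) auto
  have sL: "support_fun L' p = a * support_fun (L t) p - p \<bullet> b' - p \<bullet> c'" for p
    unfolding L'_def by (subst support_fun_homothety[OF Lt a]) (simp add: inner_diff_right)
  have lower: "r * exp t * norm p \<le> support_fun K' p" for p
    using propagate[of 1 0 "-1" 0 "- r" p] lower0 by (simp add: sK c'_def algebra_simps)
  have upper: "support_fun K' p \<le> R * exp t * norm p" for p
    using propagate[of "-1" 0 1 0 R p] upper0 by (simp add: sK c'_def algebra_simps)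
  have L_le: "support_fun L' p \<le> (1 + \<eta>) * support_fun K' p" for p
  proof -
    have "0 \<le> (1 + \<eta>) * support_fun K0 q + - a * support_fun L0 q
        + - \<eta> * (q \<bullet> c) + 1 * (q \<bullet> b) + 0 * norm q" for q
      using close0[of q] by (simp add: algebra_simps abs_le_iff)
    from propagate[OF this, of p] show ?thesis
      by (simp add: sK sL c'_def b'_def algebra_simps)
  qed
  have L_ge: "(1 - \<eta>) * support_fun K' p \<le> support_fun L' p" for p
  proof -
    have "0 \<le> - (1 - \<eta>) * support_fun K0 q + a * support_fun L0 q
        + - \<eta> * (q \<bullet> c) + - 1 * (q \<bullet> b) + 0 * norm q" for q
      using close0[of q] by (simp add: algebra_simps abs_le_iff)
    from propagate[OF this, of p] show ?thesis
      by (simp add: sK sL c'_def b'_def algebra_simps)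
  qed
  have r': "r * exp t > 0" and R': "R * exp t \<ge> 0" using r(1) \<open>R \<ge> 0\<close> by simp_all
  have inner_K': "p \<bullet> x \<le> support_fun K' p" if "x \<in> K'" for p x
    using inner_le_support_fun[OF K' that] .
  have scaled: "(*\<^sub>R) s ` K' \<in> conv_sets" for s
    using conv_sets_homothety[OF K', of s 0] by simp
  have cballK: "cball 0 (r * exp t) \<subseteq> K'"
  proof (rule subset_support_funI[OF _ K'])
    fix p x :: "real ^ 'n" assume "x \<in> cball 0 (r * exp t)"
    then show "p \<bullet> x \<le> support_fun K' p"
      using inner_le_support_fun[OF conv_sets_cball, of "r * exp t" x 0 p] lower[of p] r'
      by (simp add: support_fun_cball)
  qed
  have Kcball: "K' \<subseteq> cball 0 (R * exp t)"
  proof (rule subset_support_funI[OF _ conv_sets_cball[OF R']])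
    fix p x :: "real ^ 'n" assume "x \<in> K'"
    then show "p \<bullet> x \<le> support_fun (cball 0 (R * exp t)) p"
      using inner_K'[of x p] upper[of p] R' by (simp add: support_fun_cball)
  qed
  have KL: "(*\<^sub>R) (1 - \<eta>) ` K' \<subseteq> L'"
  proof (rule subset_support_funI[OF _ L'])
    fix p x assume "x \<in> (*\<^sub>R) (1 - \<eta>) ` K'"
    then show "p \<bullet> x \<le> support_fun L' p"
      using inner_le_support_fun[OF scaled, of x "1 - \<eta>" p] L_ge[of p] \<eta>
      by (simp add: support_fun_scaleR[OF K'])
  qed
  have LK: "L' \<subseteq> (*\<^sub>R) (1 + \<eta>) ` K'"
  proof (rule subset_support_funI[OF _ scaled])
    fix p x assume "x \<in> L'"
    then show "p \<bullet> x \<le> support_fun ((*\<^sub>R) (1 + \<eta>) ` K') p"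
      using inner_le_support_fun[OF L', of x p] L_le[of p] \<eta>
      by (simp add: support_fun_scaleR[OF K'])
  qed
  have hom: "(\<lambda>x. s *\<^sub>R x + y) \<in> homotheties" if "s > 0" for s and y :: "real ^ 'n"
    using that unfolding homotheties_def by blast
  \<comment> \<open>A solution is only known to be convex and compact. Interior points of
    \<open>K t\<close> and \<open>L t\<close> are recovered from the balls inside their homothetic
    copies \<open>K'\<close> and \<open>L'\<close>.\<close>
  have body: "X \<in> conv_bodies" if X: "X \<in> conv_sets" "s > 0"
    "(\<lambda>x. s *\<^sub>R x + y) ` X \<in> conv_bodies" for X s and y :: "real ^ 'n"
  proof -
    obtain d \<rho> where "\<rho> > 0" "cball d \<rho> \<subseteq> (\<lambda>x. s *\<^sub>R x + y) ` X"
      using X(3) by (rule conv_bodies_contains_cball)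
    then have "interior ((\<lambda>x. s *\<^sub>R x + y) ` X) \<noteq> {}"
      using mem_interior_cball by blast
    moreover have "(\<lambda>x. s *\<^sub>R x + y) ` X = (+) y ` (*\<^sub>R) s ` X"
      by (simp add: image_image add.commute)
    moreover have "interior ((*\<^sub>R) s ` X) = (*\<^sub>R) s ` interior X"
      using X(2) by (intro interior_injective_linear_image injI) (auto simp: linear_iff algebra_simps)
    ultimately show ?thesis
      using X(1,2) by (simp add: conv_bodies_def interior_translation)
  qed
  have "K' \<in> conv_bodies" using conv_bodiesI[OF K' cballK r'] .
  then have Kb: "K t \<in> conv_bodies"
    unfolding K'_def by (rule body[OF Kt, rotated]) simp
  have "(*\<^sub>R) (1 - \<eta>) ` cball 0 (r * exp t) \<subseteq> L'" using cballK KL by blast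
  then have "cball 0 ((1 - \<eta>) * (r * exp t)) \<subseteq> L'"
    using \<eta> cball_scale[of "1 - \<eta>" "0 :: real ^ 'n" "r * exp t"] by simp
  then have "L' \<in> conv_bodies" by (rule conv_bodiesI[OF L']) (use \<eta> r' in simp)
  then have Lb: "L t \<in> conv_bodies"
    unfolding L'_def by (rule body[OF Lt a])
  have "shape_dist (homothety_orbit (L t)) (homothety_orbit (K t)) = shape_dist_rep (L t) (K t)"
    unfolding shape_dist_orbit[OF Lb Kb] shape_dist_rep_def ..
  also have "\<dots> = shape_dist_rep L' K'"
    unfolding L'_def K'_def by (rule shape_dist_rep_homothety[symmetric]; rule hom) (use a in auto)
  also have "\<dots> \<le> 2 * \<eta> / (1 - \<eta>) *
      (R * exp t / (r * exp t * vol_radius (cball (0 :: real ^ 'n) 1)))"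
    by (rule shape_dist_rep_le[OF K' L' r' cballK Kcball \<eta> KL LK])
  also have "R * exp t / (r * exp t * vol_radius (cball (0 :: real ^ 'n) 1))
      = R / (r * vol_radius (cball (0 :: real ^ 'n) 1))"
    by simp
  finally show ?thesis .
qed

section \<open>Choice of constants and Lyapunov stability\<close>

theorem theorem4p1:
  fixes A :: "real ^ 'n \<Rightarrow> real ^ 'n"
    and Xs :: "real \<Rightarrow> (real ^ 'n) set" and Xs0 :: "(real ^ 'n) set"
  assumes "orthogonal_transformation A"
    and "Xs0 \<in> conv_sets" and "interior Xs0 \<noteq> {}"
    and "sde_solution A Xs0 Xs"
  shows "\<forall>\<epsilon>>0. \<exists>\<delta>>0. \<forall>X0\<in>conv_bodies.
           shape_dist (homothety_orbit X0) (homothety_orbit Xs0) < \<delta> \<longrightarrow>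
           (\<forall>X. sde_solution A X0 X \<longrightarrow>
             (\<forall>t\<ge>0. shape_dist (homothety_orbit (X t)) (homothety_orbit (Xs t)) < \<epsilon>))"
proof (intro allI impI)
  fix \<epsilon> :: real assume \<epsilon>: "\<epsilon> > 0"
  have body: "Xs0 \<in> conv_bodies" using assms(2,3) by (simp add: conv_bodies_def)
  then obtain c r where r: "r > 0" "cball c r \<subseteq> Xs0"
    by (rule conv_bodies_contains_cball)
  obtain R where R: "R > 0" "Xs0 \<subseteq> cball c R"
  proof -
    obtain e where "Xs0 \<subseteq> cball c e"
      using conv_setsD(5)[OF assms(2)] by (meson bounded_any_center bounded_def subsetI mem_cball)
    \<comment> \<open>The maximum with 1 keeps the radius positive, hence also
      \<open>C\<close>.\<close>
    then have "Xs0 \<subseteq> cball c (max e 1)" by (auto simp: max.coboundedI1)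
    then show ?thesis using that[of "max e 1"] by auto
  qed
  define C where "C = R / (r * vol_radius (cball (0 :: real ^ 'n) 1))"
  have C: "C > 0"
    unfolding C_def using R(1) r(1) vol_radius_unit_ball_pos[where 'n='n] by simp
  \<comment> \<open>The bound \<open>1 / 2\<close> gives
    \<open>2 * \<eta> / (1 - \<eta>) \<le> 4 * \<eta>\<close>; the other bound then brings the final
    estimate down to \<open>\<epsilon> / 2\<close>.\<close>
  define \<eta> where "\<eta> = min (1 / 2) (\<epsilon> / (8 * C))"
  have \<eta>: "\<eta> > 0" "\<eta> \<le> 1 / 2" "\<eta> \<le> \<epsilon> / (8 * C)"
    using \<epsilon> C by (auto simp: \<eta>_def)
  have "2 * \<eta> / (1 - \<eta>) \<le> 4 * \<eta>" using \<eta> by (simp add: field_simps)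
  then have "2 * \<eta> / (1 - \<eta>) * C \<le> 4 * \<eta> * C" using C by (intro mult_right_mono) auto
  also have "\<dots> \<le> \<epsilon> / 2" using \<eta>(3) C by (simp add: field_simps)
  finally have small: "2 * \<eta> / (1 - \<eta>) * C < \<epsilon>" using \<epsilon> by linarith
  let ?v = "vol_radius Xs0"
  have v: "?v > 0" using vol_radius_pos[OF body] .
  show "\<exists>\<delta>>0. \<forall>X0\<in>conv_bodies.
           shape_dist (homothety_orbit X0) (homothety_orbit Xs0) < \<delta> \<longrightarrow>
           (\<forall>X. sde_solution A X0 X \<longrightarrow>
             (\<forall>t\<ge>0. shape_dist (homothety_orbit (X t)) (homothety_orbit (Xs t)) < \<epsilon>))"
  \<comment> \<open>Undoing the normalisation of \<open>Xs0\<close> multiplies distances by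
    \<open>?v\<close>, which turns this \<open>\<delta>\<close> into the tolerance
    \<open>\<eta> * r\<close>.\<close>
  proof (intro exI[of _ "\<eta> * r / ?v"] conjI ballI impI allI)
    show "\<eta> * r / ?v > 0" using \<eta> r v by simp
    fix X0 X and t :: real
    assume X0: "X0 \<in> conv_bodies"
      and near: "shape_dist (homothety_orbit X0) (homothety_orbit Xs0) < \<eta> * r / ?v"
      and sol: "sde_solution A X0 X" and t: "0 \<le> t"
    let ?w = "vol_radius X0"
    have w: "?w > 0" using vol_radius_pos[OF X0] .
    have X0': "X0 \<in> conv_sets" using X0 by (simp add: conv_bodies_def)
    \<comment> \<open>Strictness lets a translation beat the bound, whether or not the infimum is
      attained.\<close>
    obtain x where x: "hausdorff_dist (vol_normalize X0) ((+) x ` vol_normalize Xs0) < \<eta> * r / ?v"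
      using near cInf_lessD[of "{hausdorff_dist (vol_normalize X0) ((+) x ` vol_normalize Xs0) |x. True}"]
      unfolding shape_dist_orbit[OF X0 body] by auto
    have eq: "(+) x ` vol_normalize Xs0 = (\<lambda>y. inverse ?v *\<^sub>R y + x) ` Xs0"
      by (simp add: vol_normalize_eq image_image add.commute)
    \<comment> \<open>The homothetic copy of \<open>X0\<close> to compare has factor
      \<open>?v / ?w\<close>, offset from \<open>Xs0\<close> by \<open>?v *\<^sub>R x\<close>: the
      normalised comparison multiplied by \<open>?v\<close>.\<close>
    have close: "\<bar>?v / ?w * support_fun X0 q - support_fun Xs0 q - q \<bullet> (?v *\<^sub>R x)\<bar> \<le> \<eta> * (r * norm q)" for q
    proof -
      have "\<bar>support_fun (vol_normalize X0) q - support_fun ((+) x ` vol_normalize Xs0) q\<bar>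
          \<le> hausdorff_dist (vol_normalize X0) ((+) x ` vol_normalize Xs0) * norm q"
        by (intro abs_support_fun_diff_le conv_sets_vol_normalize X0')
          (simp add: eq conv_sets_homothety assms(2))
      also have "\<dots> \<le> \<eta> * r / ?v * norm q" using x by (intro mult_right_mono) auto
      finally have "\<bar>support_fun X0 q / ?w - (support_fun Xs0 q / ?v + q \<bullet> x)\<bar> \<le> \<eta> * r / ?v * norm q"
        unfolding eq unfolding vol_normalize_eq using v w
        by (simp add: support_fun_scaleR[OF X0'] support_fun_homothety[OF assms(2)] divide_inverse mult.commute)
      then have "?v * \<bar>support_fun X0 q / ?w - (support_fun Xs0 q / ?v + q \<bullet> x)\<bar>
          \<le> ?v * (\<eta> * r / ?v * norm q)"
        using v by (intro mult_left_mono) auto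
      also have "?v * \<bar>support_fun X0 q / ?w - (support_fun Xs0 q / ?v + q \<bullet> x)\<bar>
          = \<bar>?v * (support_fun X0 q / ?w - (support_fun Xs0 q / ?v + q \<bullet> x))\<bar>"
        using v by (simp add: abs_mult)
      also have "?v * (support_fun X0 q / ?w - (support_fun Xs0 q / ?v + q \<bullet> x))
          = ?v / ?w * support_fun X0 q - support_fun Xs0 q - q \<bullet> (?v *\<^sub>R x)"
        using v by (simp add: right_diff_distrib distrib_left)
      finally show ?thesis using v by simp
    qed
    have "shape_dist (homothety_orbit (X t)) (homothety_orbit (Xs t)) \<le> 2 * \<eta> / (1 - \<eta>) * C"
      unfolding C_def
      by (rule solution_shape_dist_le[OF assms(1) t assms(4) sol r R(2) _ _ _ close])
        (use v w \<eta> in auto)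
    then show "shape_dist (homothety_orbit (X t)) (homothety_orbit (Xs t)) < \<epsilon>"
      using small by linarith
  qed
qed

end
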